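(* Let $k$ be a positive semi-definite kernel on a metric measure space $\mathcal{M}$ with reproducing kernel Hilbert space $\mathcal{H}_k$, and let $f$ be a Gaussian process with covariance $k$. Let $\mathcal{X}\subseteq\mathcal{M}$ be compact (with finite measure), and let $\tilde f$ be a standard normal Bayesian linear model with $\ell$ basis functions $\phi_1,\dots,\phi_\ell$, each of which lies locally in $\mathcal{H}_k$ for $\mathcal{X}$. Let $X_n\subset\mathcal{X}$ be a finite set of $n$ points with $K_{n,n}=k(X_n,X_n)$ invertible, let $y\in\mathbb{R}^n$, and define $$(f\mid y)(\cdot)=f(\cdot)+k(\cdot,X_n)K_{n,n}^{-1}(y-f(X_n)),\qquad (\tilde f\mid y)(\cdot)=\tilde f(\cdot)+k(\cdot,X_n)K_{n,n}^{-1}(y-\tilde f(X_n)).$$ If $X_n$ is such that $\sup_{x\in\mathcal{X}}k^{(f\mid y)}(x,x)\le\varepsilon$, then $$\sup_{x\in\mathcal{X}}\bigl|k^{(\tilde f\mid y)}(x,x)\bigr|\le C_4\,\varepsilon,\qquad C_4=\ell\,\max_{1\le i\le\ell}\ \inf\bigl\{\|\psi\|_{\mathcal{H}_k}^2:\ \psi\in\mathcal{H}_k,\ \psi|_{\mathcal{X}}=\phi_i|_{\mathcal{X}}\bigr\}.$$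
   Context: A standard normal Bayesian linear model is a random function $\tilde f(\cdot)=\sum_{i=1}^\ell w_i\phi_i(\cdot)$ with i.i.d. $w_i\sim\mathcal{N}(0,1)$ and linearly independent (deterministic) basis functions $\phi_i:\mathcal{M}\to\mathbb{R}$. A function $\phi_i$ lies locally in $\mathcal{H}_k$ for $\mathcal{X}$ if there is $\psi\in\mathcal{H}_k$ with $\psi|_{\mathcal{X}}=\phi_i|_{\mathcal{X}}$. For $X_n=(x_1,\dots,x_n)$: $k(\cdot,X_n)=(k(\cdot,x_1),\dots,k(\cdot,x_n))$, $k(X_n,X_n)=(k(x_i,x_j))_{i,j}$, $f(X_n)=(f(x_1),\dots,f(x_n))^\top$. The process $f\mid y$ is (in distribution) $f$ conditioned on the noise-free observations $f(X_n)=y$; $\tilde f\mid y$ applies the same update (with the true kernel $k$) to $\tilde f$. $k^{(f\mid y)}$ and $k^{(\tilde f\mid y)}$ denote the covariance functions of $f\mid y$ and $\tilde f\mid y$, respectively; in particular $k^{(f\mid y)}(x,x')=k(x,x')-k(x,X_n)K_{n,n}^{-1}k(X_n,x')$. *)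

theory Defs
  imports "HOL-Probability.Probability"
begin

section \<open>Kernels and reproducing kernel Hilbert spaces\<close>

definition psd_kernel :: "('m \<Rightarrow> 'm \<Rightarrow> real) \<Rightarrow> bool" where
  "psd_kernel k \<longleftrightarrow>
     (\<forall>s t. k s t = k t s) \<and>
     (\<forall>(n::nat) (x :: nat \<Rightarrow> 'm) (c :: nat \<Rightarrow> real).
        0 \<le> (\<Sum>i<n. \<Sum>j<n. c i * c j * k (x i) (x j)))"

text \<open>
  Only the values of \<open>ip\<close> on \<open>H\<close> matter. By the Moore--Aronszajn theorem a positive semi-definite
  kernel \<open>k\<close> determines \<open>H\<close>, and \<open>ip\<close> on \<open>H\<close>, uniquely.
\<close>

locale rkhs =
  fixes k :: "'m \<Rightarrow> 'm \<Rightarrow> real"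
    and H :: "('m \<Rightarrow> real) set"
    and ip :: "('m \<Rightarrow> real) \<Rightarrow> ('m \<Rightarrow> real) \<Rightarrow> real"
  assumes zero_mem: "(\<lambda>t. 0) \<in> H"
    and add_mem: "\<lbrakk>f \<in> H; g \<in> H\<rbrakk> \<Longrightarrow> (\<lambda>t. f t + g t) \<in> H"
    and scale_mem: "f \<in> H \<Longrightarrow> (\<lambda>t. c * f t) \<in> H"
    and ip_sym: "\<lbrakk>f \<in> H; g \<in> H\<rbrakk> \<Longrightarrow> ip f g = ip g f"
    and ip_add: "\<lbrakk>f \<in> H; g \<in> H; h \<in> H\<rbrakk> \<Longrightarrow> ip (\<lambda>t. f t + g t) h = ip f h + ip g h"
    and ip_scale: "\<lbrakk>f \<in> H; h \<in> H\<rbrakk> \<Longrightarrow> ip (\<lambda>t. c * f t) h = c * ip f h"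
    and ip_nonneg: "f \<in> H \<Longrightarrow> 0 \<le> ip f f"
    and ip_definite: "\<lbrakk>f \<in> H; ip f f = 0\<rbrakk> \<Longrightarrow> f = (\<lambda>t. 0)"
    and complete: "Metric_space.mcomplete H
          (\<lambda>f g. sqrt (ip (\<lambda>t. f t - g t) (\<lambda>t. f t - g t)))"
    and kernel_mem: "(\<lambda>s. k s t) \<in> H"
    and reproducing: "f \<in> H \<Longrightarrow> ip f (\<lambda>s. k s t) = f t"

definition ip_norm :: "(('m \<Rightarrow> real) \<Rightarrow> ('m \<Rightarrow> real) \<Rightarrow> real) \<Rightarrow> ('m \<Rightarrow> real) \<Rightarrow> real" where
  "ip_norm ip f = sqrt (ip f f)"

definition local_extensions ::
    "('m \<Rightarrow> real) set \<Rightarrow> 'm set \<Rightarrow> ('m \<Rightarrow> real) \<Rightarrow> ('m \<Rightarrow> real) set" where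
  "local_extensions H X \<phi> = {\<psi> \<in> H. restrict \<psi> X = restrict \<phi> X}"

definition lies_locally_in ::
    "('m \<Rightarrow> real) \<Rightarrow> ('m \<Rightarrow> real) set \<Rightarrow> 'm set \<Rightarrow> bool" where
  "lies_locally_in \<phi> H X \<longleftrightarrow> (\<exists>\<psi> \<in> H. restrict \<psi> X = restrict \<phi> X)"

section \<open>Random functions\<close>

text \<open>A random function \<open>f\<close> is written \<open>f t \<omega>\<close>, with index \<open>t\<close> first and sample point \<open>\<omega>\<close> second.\<close>

definition covariance :: "'w measure \<Rightarrow> ('w \<Rightarrow> real) \<Rightarrow> ('w \<Rightarrow> real) \<Rightarrow> real" where
  "covariance P U V =
     (\<integral>\<omega>. (U \<omega> - (\<integral>\<omega>'. U \<omega>' \<partial>P)) * (V \<omega> - (\<integral>\<omega>'. V \<omega>' \<partial>P)) \<partial>P)"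

definition cov_fun :: "'w measure \<Rightarrow> ('m \<Rightarrow> 'w \<Rightarrow> real) \<Rightarrow> 'm \<Rightarrow> 'm \<Rightarrow> real" where
  "cov_fun P f s t = covariance P (f s) (f t)"

text \<open>
  Degenerate (almost surely constant) Gaussians are included, since \<open>k\<close> is only semi-definite;
  they have no density, hence the separate disjunct.
\<close>

definition gaussian_rv :: "'w measure \<Rightarrow> ('w \<Rightarrow> real) \<Rightarrow> bool" where
  "gaussian_rv P U \<longleftrightarrow> U \<in> borel_measurable P \<and>
     ((\<exists>\<mu>. AE \<omega> in P. U \<omega> = \<mu>) \<or>
      (\<exists>\<mu> \<sigma>. 0 < \<sigma> \<and> distributed P lborel U (normal_density \<mu> \<sigma>)))"

text \<open>
  All finite-dimensional distributions are multivariate normal, a random vector being multivariate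
  normal if all linear combinations of its entries are normal. The mean function is arbitrary.
\<close>

definition gaussian_process :: "'w measure \<Rightarrow> ('m \<Rightarrow> 'w \<Rightarrow> real) \<Rightarrow> bool" where
  "gaussian_process P f \<longleftrightarrow> prob_space P \<and>
     (\<forall>A c. finite A \<longrightarrow> gaussian_rv P (\<lambda>\<omega>. \<Sum>t\<in>A. c t * f t \<omega>))"

definition linearly_independent_funs :: "nat \<Rightarrow> (nat \<Rightarrow> 'm \<Rightarrow> real) \<Rightarrow> bool" where
  "linearly_independent_funs l \<phi> \<longleftrightarrow>
     (\<forall>c. (\<forall>t. (\<Sum>i=1..l. c i * \<phi> i t) = 0) \<longrightarrow> (\<forall>i\<in>{1..l}. c i = 0))"

definition std_normal_blm ::
    "'w measure \<Rightarrow> nat \<Rightarrow> (nat \<Rightarrow> 'm \<Rightarrow> real) \<Rightarrow> ('m \<Rightarrow> 'w \<Rightarrow> real) \<Rightarrow> bool" where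
  "std_normal_blm P l \<phi> g \<longleftrightarrow> prob_space P \<and> linearly_independent_funs l \<phi> \<and>
     (\<exists>w. prob_space.indep_vars P (\<lambda>_. borel) w {1..l} \<and>
          (\<forall>i\<in>{1..l}. distributed P lborel (w i) std_normal_density) \<and>
          (\<forall>t. \<forall>\<omega>\<in>space P. g t \<omega> = (\<Sum>i=1..l. w i \<omega> * \<phi> i t)))"

section \<open>Conditioning on noise-free observations\<close>

definition kernel_vector :: "('m \<Rightarrow> 'm \<Rightarrow> real) \<Rightarrow> 'm \<Rightarrow> ('n \<Rightarrow> 'm) \<Rightarrow> real ^ 'n" where
  "kernel_vector k t x = (\<chi> i. k t (x i))"

definition kernel_matrix :: "('m \<Rightarrow> 'm \<Rightarrow> real) \<Rightarrow> ('n \<Rightarrow> 'm) \<Rightarrow> real ^ 'n ^ 'n" where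
  "kernel_matrix k x = (\<chi> i j. k (x i) (x j))"

definition conditioned ::
    "('m \<Rightarrow> 'm \<Rightarrow> real) \<Rightarrow> ('n::finite \<Rightarrow> 'm) \<Rightarrow> real ^ 'n \<Rightarrow> ('m \<Rightarrow> 'w \<Rightarrow> real) \<Rightarrow> 'm \<Rightarrow> 'w \<Rightarrow> real" where
  "conditioned k x y f t \<omega> =
     f t \<omega> + kernel_vector k t x \<bullet> (matrix_inv (kernel_matrix k x) *v (y - (\<chi> i. f (x i) \<omega>)))"

end

theory Submission
  imports Defs
begin

text \<open>
  For fixed \<open>t\<close> and observation points, conditioning is the same affine functional of the process for
  \<open>f\<close> and \<open>ft\<close>: a constant plus \<open>\<Sum>\<^sub>i c\<^sub>i f(z\<^sub>i)\<close>, where the \<open>z\<^sub>i\<close> are \<open>t\<close> and the observation points.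
  With \<open>h = \<Sum>\<^sub>i c\<^sub>i k(\<cdot>, z\<^sub>i)\<close>, the variance of \<open>f | y\<close> at \<open>t\<close> is \<open>\<parallel>h\<parallel>\<^sup>2\<close>, while that of \<open>ft | y\<close> is
  \<open>\<Sum>\<^sub>i (\<Sum>\<^sub>j c\<^sub>j \<phi>\<^sub>i(z\<^sub>j))\<^sup>2 = \<Sum>\<^sub>i \<langle>\<psi>\<^sub>i, h\<rangle>\<^sup>2\<close> for any extensions \<open>\<psi>\<^sub>i\<close> of \<open>\<phi>\<^sub>i\<close>, because all \<open>z\<^sub>j\<close> lie
  in \<open>X\<close>. Cauchy--Schwarz bounds each summand by \<open>\<parallel>\<psi>\<^sub>i\<parallel>\<^sup>2 \<parallel>h\<parallel>\<^sup>2\<close>. The particular weights \<open>c\<close> are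
  irrelevant.
\<close>

section \<open>Cauchy--Schwarz and finite kernel combinations in the Hilbert space\<close>

context rkhs
begin

lemma ip_zero_left: "g \<in> H \<Longrightarrow> ip (\<lambda>t. 0) g = 0"
  using ip_scale[OF zero_mem, of g 0] by simp

lemma ip_Cauchy_Schwarz:
  assumes f: "f \<in> H" and g: "g \<in> H"
  shows "(ip f g)\<^sup>2 \<le> ip f f * ip g g"
proof (cases "ip g g = 0")
  case True
  then have "g = (\<lambda>t. 0)" by (rule ip_definite[OF g])
  then have "ip f g = 0" using ip_zero_left[OF f] ip_sym[OF f g] by simp
  then show ?thesis using True by simp
next
  case False
  then have pos: "ip g g > 0" using ip_nonneg[OF g] by simp
  \<comment> \<open>This \<open>r\<close> minimises the quadratic
    \<open>ip (f + r g) (f + r g)\<close>; nonnegativity of the minimum is the claim divided by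
    \<open>ip g g\<close>.\<close>
  define r where "r = - ip f g / ip g g"
  have rg: "(\<lambda>t. r * g t) \<in> H" by (rule scale_mem[OF g])
  let ?u = "\<lambda>t. f t + r * g t"
  have u: "?u \<in> H" by (rule add_mem[OF f rg])
  have fu: "ip f ?u = ip f f + r * ip f g"
    using ip_sym[OF f u] ip_add[OF f rg f] ip_scale[OF g f, of r] ip_sym[OF f g] by simp
  have gu: "ip g ?u = ip f g + r * ip g g"
    using ip_sym[OF g u] ip_add[OF f rg g] ip_scale[OF g g, of r] by simp
  have "ip ?u ?u = ip f ?u + r * ip g ?u"
    using ip_add[OF f rg u] ip_scale[OF g u, of r] by simp
  then have "0 \<le> ip f f + r * ip f g + r * (ip f g + r * ip g g)"
    using ip_nonneg[OF u] fu gu by simp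
  also have "\<dots> = ip f f - (ip f g)\<^sup>2 / ip g g"
    using pos by (simp add: r_def field_simps power2_eq_square)
  finally show ?thesis using pos by (simp add: field_simps)
qed

text \<open>The reproducing property extended by linearity: the kernel combination represents the
  functional that sends \<open>g\<close> to the weighted sum of its values at the
  \<open>z i\<close>. Membership and representation go through one induction, since
  \<open>ip_add\<close> asks for membership of the partial sum.\<close>

lemma kernel_sum:
  assumes "finite I"
  shows kernel_sum_mem: "(\<lambda>s. \<Sum>i\<in>I. c i * k s (z i)) \<in> H"
    and ip_kernel_sum: "g \<in> H \<Longrightarrow> ip g (\<lambda>s. \<Sum>i\<in>I. c i * k s (z i)) = (\<Sum>i\<in>I. c i * g (z i))"
proof -
  have "(\<lambda>s. \<Sum>i\<in>I. c i * k s (z i)) \<in> H \<and>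
    (\<forall>g\<in>H. ip (\<lambda>s. \<Sum>i\<in>I. c i * k s (z i)) g = (\<Sum>i\<in>I. c i * g (z i)))"
    using assms
  proof (induction I)
    case empty
    then show ?case by (simp add: zero_mem ip_zero_left)
  next
    case (insert a I)
    let ?h = "\<lambda>s. \<Sum>i\<in>I. c i * k s (z i)" and ?k = "\<lambda>s. k s (z a)"
    have ka: "(\<lambda>s. c a * ?k s) \<in> H" by (rule scale_mem[OF kernel_mem])
    have "ip (\<lambda>s. c a * ?k s + ?h s) g = c a * g (z a) + (\<Sum>i\<in>I. c i * g (z i))" if g: "g \<in> H" for g
      using ip_add[OF ka _ g, of ?h] insert.IH ip_scale[OF kernel_mem g, of "c a" "z a"]
        ip_sym[OF g kernel_mem] reproducing[OF g] g by simp
    then show ?case using add_mem[OF ka, of ?h] insert by simp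
  qed
  then show "(\<lambda>s. \<Sum>i\<in>I. c i * k s (z i)) \<in> H"
    and "g \<in> H \<Longrightarrow> ip g (\<lambda>s. \<Sum>i\<in>I. c i * k s (z i)) = (\<Sum>i\<in>I. c i * g (z i))"
    using ip_sym by auto
qed

text \<open>The double sum is the squared norm of the combination from
  \<open>kernel_sum\<close>.\<close>

lemma kernel_form_nonneg:
  assumes "finite I"
  shows "0 \<le> (\<Sum>i\<in>I. \<Sum>j\<in>I. c i * c j * k (z i) (z j))"
  using ip_nonneg[OF kernel_sum_mem[OF assms, of c z]]
  by (simp add: ip_kernel_sum[OF assms kernel_sum_mem[OF assms]] sum_distrib_left mult.assoc)

lemma square_lincomb_le:
  assumes I: "finite I" and g: "g \<in> H"
  shows "(\<Sum>i\<in>I. c i * g (z i))\<^sup>2 \<le> (ip_norm ip g)\<^sup>2 * (\<Sum>i\<in>I. \<Sum>j\<in>I. c i * c j * k (z i) (z j))"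
  using ip_Cauchy_Schwarz[OF g kernel_sum_mem[OF I, of c z]] ip_nonneg[OF g]
  by (simp add: ip_kernel_sum[OF I kernel_sum_mem[OF I]] ip_kernel_sum[OF I g] ip_norm_def
      sum_distrib_left mult.assoc)

text \<open>On \<open>X\<close> every extension agrees with \<open>\<phi>\<close>, so
  \<open>square_lincomb_le\<close> applies to each extension; the bound then passes to the
  infimum.\<close>

lemma square_lincomb_le_INF:
  assumes I: "finite I" and z: "z ` I \<subseteq> X" and loc: "lies_locally_in \<phi> H X"
  shows "(\<Sum>i\<in>I. c i * \<phi> (z i))\<^sup>2
    \<le> (INF \<psi>\<in>local_extensions H X \<phi>. (ip_norm ip \<psi>)\<^sup>2) * (\<Sum>i\<in>I. \<Sum>j\<in>I. c i * c j * k (z i) (z j))"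
    (is "?s \<le> (INF \<psi>\<in>?E. ?N \<psi>) * ?v")
proof -
  have ne: "?E \<noteq> {}"
    using loc by (auto simp: lies_locally_in_def local_extensions_def)
  have le: "?s \<le> ?N \<psi> * ?v" if "\<psi> \<in> ?E" for \<psi>
  proof -
    have "\<psi> s = \<phi> s" if "s \<in> X" for s
      using \<open>\<psi> \<in> ?E\<close> that unfolding local_extensions_def by (metis (mono_tags) mem_Collect_eq restrict_apply')
    then have "(\<Sum>i\<in>I. c i * \<phi> (z i)) = (\<Sum>i\<in>I. c i * \<psi> (z i))"
      using z by (intro sum.cong) auto
    then show ?thesis
      using square_lincomb_le[OF I, of \<psi> c z] that by (simp add: local_extensions_def)
  qed
  \<comment> \<open>Dividing by \<open>?v\<close> isolates the infimum. If \<open>?v\<close>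
    vanishes, a single extension already forces \<open>?s\<close> to be at most 0.\<close>
  show ?thesis
  proof (cases "?v = 0")
    case True
    then show ?thesis using ne le by auto
  next
    case False
    then have v: "?v > 0" using kernel_form_nonneg[OF I, of c z] by linarith
    have "?s / ?v \<le> (INF \<psi>\<in>?E. ?N \<psi>)"
      using ne le v by (intro cINF_greatest) (simp_all add: pos_divide_le_eq)
    then show ?thesis using v by (simp add: pos_divide_le_eq)
  qed
qed

end

section \<open>Variances of affine combinations of random variables\<close>

lemma gaussian_rv_square_integrable:
  assumes "prob_space P" and U: "gaussian_rv P U"
  shows "integrable P (\<lambda>\<omega>. (U \<omega>)\<^sup>2)"
proof -
  interpret prob_space P by fact
  have [measurable]: "U \<in> borel_measurable P" using U by (simp add: gaussian_rv_def)
  from U consider (const) m where "AE \<omega> in P. U \<omega> = m"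
    | (normal) m s where "0 < s" "distributed P lborel U (normal_density m s)"
    by (auto simp: gaussian_rv_def)
  then show ?thesis
  proof cases
    case const
    then have "AE \<omega> in P. (U \<omega>)\<^sup>2 = m\<^sup>2" by auto
    then show ?thesis
      by (subst integrable_cong_AE[where g = "\<lambda>_. m\<^sup>2"]) auto
  next
    case normal
    \<comment> \<open>The expansion \<open>x^2 = (x - m)^2 + 2 m x - m^2\<close> reduces the claim
      to the second central moment, the first moment and the total mass.\<close>
    have "integrable lborel (\<lambda>x. normal_density m s x * (x - m)^2
        + 2 * m * (normal_density m s x * x) - m\<^sup>2 * normal_density m s x)"
      using integrable_normal_moment[OF normal(1), of m 2] integrable_normal_moment_nz_1[OF normal(1), of m]
        integrable_normal_density[OF normal(1), of m]
      by (intro Bochner_Integration.integrable_add Bochner_Integration.integrable_diff integrable_mult_right)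
    also have "(\<lambda>x. normal_density m s x * (x - m)^2
        + 2 * m * (normal_density m s x * x) - m\<^sup>2 * normal_density m s x)
      = (\<lambda>x. normal_density m s x * x\<^sup>2)"
      by (auto simp: power2_eq_square algebra_simps)
    finally show ?thesis
      using distributed_integrable[OF normal(2), of "\<lambda>x. x\<^sup>2"] by simp
  qed
qed

text \<open>Centring cancels \<open>b\<close>, and bilinearity does the rest. The lemma serves
  twice: with process values as the \<open>Z i\<close>, and with the weights of the linear
  model.\<close>

lemma covariance_affine:
  assumes "prob_space P" and "finite I"
    and Z: "\<And>i. i \<in> I \<Longrightarrow> gaussian_rv P (Z i)"
    and U: "\<And>\<omega>. \<omega> \<in> space P \<Longrightarrow> U \<omega> = b + (\<Sum>i\<in>I. c i * Z i \<omega>)"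
  shows "covariance P U U = (\<Sum>i\<in>I. \<Sum>j\<in>I. c i * c j * covariance P (Z i) (Z j))"
proof -
  interpret prob_space P by fact
  define m where "m = (\<lambda>i. expectation (Z i))"
  have meas: "Z i \<in> borel_measurable P" if "i \<in> I" for i
    using Z[OF that] by (simp add: gaussian_rv_def)
  have sq: "integrable P (\<lambda>\<omega>. (Z i \<omega>)\<^sup>2)" if "i \<in> I" for i
    by (rule gaussian_rv_square_integrable[OF \<open>prob_space P\<close> Z[OF that]])
  have int: "integrable P (Z i)" if "i \<in> I" for i
    by (rule square_integrable_imp_integrable[OF meas[OF that] sq[OF that]])
  have sqc: "integrable P (\<lambda>\<omega>. (Z i \<omega> - m i)\<^sup>2)" if "i \<in> I" for i
    using sq[OF that] int[OF that] by (simp add: power2_diff)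
  \<comment> \<open>Integrability of the products, by domination with a sum of squares, lets the
    expectation pass through the double sum.\<close>
  have prod: "integrable P (\<lambda>\<omega>. (Z i \<omega> - m i) * (Z j \<omega> - m j))" if "i \<in> I" "j \<in> I" for i j
  proof (rule Bochner_Integration.integrable_bound)
    show "integrable P (\<lambda>\<omega>. (Z i \<omega> - m i)\<^sup>2 + (Z j \<omega> - m j)\<^sup>2)"
      using sqc that by (intro Bochner_Integration.integrable_add) auto
    show "(\<lambda>\<omega>. (Z i \<omega> - m i) * (Z j \<omega> - m j)) \<in> borel_measurable P"
      using meas that by (intro borel_measurable_times borel_measurable_diff) auto
    have "\<bar>p * q\<bar> \<le> p\<^sup>2 + q\<^sup>2" for p q :: real
      using sum_squares_bound[of "\<bar>p\<bar>" "\<bar>q\<bar>"] abs_ge_zero[of "p * q"]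
      unfolding abs_mult power2_abs by linarith
    then show "AE \<omega> in P. norm ((Z i \<omega> - m i) * (Z j \<omega> - m j)) \<le> norm ((Z i \<omega> - m i)\<^sup>2 + (Z j \<omega> - m j)\<^sup>2)"
      by simp
  qed
  have EU: "expectation U = b + (\<Sum>i\<in>I. c i * m i)"
  proof -
    have "expectation U = expectation (\<lambda>\<omega>. b + (\<Sum>i\<in>I. c i * Z i \<omega>))"
      using U by (intro Bochner_Integration.integral_cong) auto
    then show ?thesis using int by (simp add: m_def prob_space)
  qed
  have "covariance P U U = expectation (\<lambda>\<omega>. \<Sum>i\<in>I. \<Sum>j\<in>I. c i * c j * ((Z i \<omega> - m i) * (Z j \<omega> - m j)))"
    unfolding covariance_def EU
  proof (intro Bochner_Integration.integral_cong refl)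
    fix \<omega> assume "\<omega> \<in> space P"
    then have "U \<omega> - (b + (\<Sum>i\<in>I. c i * m i)) = (\<Sum>i\<in>I. c i * (Z i \<omega> - m i))"
      by (simp add: U sum_subtractf right_diff_distrib)
    then show "(U \<omega> - (b + (\<Sum>i\<in>I. c i * m i))) * (U \<omega> - (b + (\<Sum>i\<in>I. c i * m i)))
      = (\<Sum>i\<in>I. \<Sum>j\<in>I. c i * c j * ((Z i \<omega> - m i) * (Z j \<omega> - m j)))"
      by (simp add: sum_product mult_ac)
  qed
  also have "\<dots> = (\<Sum>i\<in>I. \<Sum>j\<in>I. c i * c j * covariance P (Z i) (Z j))"
    using prod by (simp add: covariance_def m_def)
  finally show ?thesis .
qed

lemma (in prob_space) covariance_indep_std_normal:
  assumes indep: "indep_vars (\<lambda>_. borel) w I"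
    and normal: "\<And>i. i \<in> I \<Longrightarrow> distributed M lborel (w i) std_normal_density"
    and "i \<in> I" "j \<in> I"
  shows "covariance M (w i) (w j) = (if i = j then 1 else 0)"
proof (cases "i = j")
  case True
  then show ?thesis
    using standard_normal_distributed_variance[OF normal[OF \<open>i \<in> I\<close>]]
    by (simp add: covariance_def power2_eq_square)
next
  case False
  have int: "integrable M (w i)" if "i \<in> I" for i
    using distributed_integrable[OF normal[OF that], of "\<lambda>x. x"] integrable_std_normal_moment[of 1]
    by simp
  \<comment> \<open>\<open>indep_vars_sum\<close> separates one variable from the sum of the others;
    over the singleton \<open>{j}\<close> that sum is \<open>w j\<close>.\<close>
  have "indep_vars (\<lambda>_. borel) w (insert i {j})"
    using indep by (rule indep_vars_subset) (use assms in auto)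
  then have "indep_var borel (w i) borel (w j)"
    using indep_vars_sum[of "{j}" i w] False by simp
  then have "expectation (\<lambda>\<omega>. w i \<omega> * w j \<omega>) = expectation (w i) * expectation (w j)"
    using int assms by (intro indep_var_lebesgue_integral) auto
  then show ?thesis
    using False assms by (simp add: covariance_def standard_normal_distributed_expectation[OF normal])
qed

text \<open>The index type is \<open>'n option\<close>: \<open>None\<close> stands for
  \<open>t\<close> with weight 1, \<open>Some j\<close> for the observation point
  \<open>x j\<close>. Indexing by positions rather than points keeps the formula valid when
  \<open>t\<close> is itself an observation point.\<close>

lemma conditioned_affine:
  fixes k :: "'m \<Rightarrow> 'm \<Rightarrow> real" and x :: "'n::finite \<Rightarrow> 'm"
  defines "K \<equiv> matrix_inv (kernel_matrix k x)"
  shows "conditioned k x y f t \<omega> = kernel_vector k t x \<bullet> (K *v y)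
    + (\<Sum>i\<in>UNIV. case_option 1 (\<lambda>j. - (kernel_vector k t x v* K) $ j) i * f (case_option t x i) \<omega>)"
proof -
  have "kernel_vector k t x \<bullet> (K *v (\<chi> i. f (x i) \<omega>)) = (\<Sum>j\<in>UNIV. (kernel_vector k t x v* K) $ j * f (x j) \<omega>)"
    unfolding dot_lmul_matrix[symmetric] by (simp add: inner_vec_def)
  then show ?thesis
    by (simp add: conditioned_def K_def[symmetric] matrix_vector_mult_diff_distrib inner_diff_right
        UNIV_option_conv sum.reindex sum_negf)
qed

section \<open>Comparison of the two conditioned variances\<close>

theorem proposition7:
  fixes \<mu> :: "'m::metric_space measure"
    and k :: "'m \<Rightarrow> 'm \<Rightarrow> real"
    and H :: "('m \<Rightarrow> real) set"
    and ip :: "('m \<Rightarrow> real) \<Rightarrow> ('m \<Rightarrow> real) \<Rightarrow> real"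
    and P :: "'w measure" and f :: "'m \<Rightarrow> 'w \<Rightarrow> real"
    and Q :: "'v measure" and ft :: "'m \<Rightarrow> 'v \<Rightarrow> real"
    and \<phi> :: "nat \<Rightarrow> 'm \<Rightarrow> real" and l :: nat
    and X :: "'m set"
    and x :: "'n::finite \<Rightarrow> 'm" and y :: "real ^ 'n"
    and \<epsilon> :: real
  assumes "sets \<mu> = sets borel"
    and "psd_kernel k"
    and "rkhs k H ip"
    and "gaussian_process P f"
    and "\<And>s t. cov_fun P f s t = k s t"
    and "compact X" and "emeasure \<mu> X < \<infinity>"
    and "1 \<le> l"
    and "std_normal_blm Q l \<phi> ft"
    and "\<And>i. i \<in> {1..l} \<Longrightarrow> lies_locally_in (\<phi> i) H X"
    and "inj x" and "range x \<subseteq> X"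
    and "invertible (kernel_matrix k x)"
    and "(SUP t\<in>X. ereal (cov_fun P (conditioned k x y f) t t)) \<le> ereal \<epsilon>"
  shows "(SUP t\<in>X. ereal \<bar>cov_fun Q (conditioned k x y ft) t t\<bar>)
    \<le> ereal (real l * (MAX i\<in>{1..l}. INF \<psi>\<in>local_extensions H X (\<phi> i). (ip_norm ip \<psi>)\<^sup>2) * \<epsilon>)"
proof -
  interpret rkhs k H ip by fact
  interpret P: prob_space P using assms(4) by (simp add: gaussian_process_def)
  interpret Q: prob_space Q using assms(9) by (simp add: std_normal_blm_def)
  define E where "E = (\<lambda>i. INF \<psi>\<in>local_extensions H X (\<phi> i). (ip_norm ip \<psi>)\<^sup>2)"
  define M where "M = (MAX i\<in>{1..l}. E i)"
  obtain w where w: "Q.indep_vars (\<lambda>_. borel) w {1..l}"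
    "\<And>i. i \<in> {1..l} \<Longrightarrow> distributed Q lborel (w i) std_normal_density"
    "\<And>t \<omega>. \<omega> \<in> space Q \<Longrightarrow> ft t \<omega> = (\<Sum>i=1..l. w i \<omega> * \<phi> i t)"
    using assms(9) by (auto simp: std_normal_blm_def)
  have f: "gaussian_rv P (f t)" for t
    using assms(4)[unfolded gaussian_process_def, THEN conjunct2, rule_format, of "{t}" "\<lambda>_. 1"] by simp
  have gw: "gaussian_rv Q (w i)" if "i \<in> {1..l}" for i
    unfolding gaussian_rv_def using w(2)[OF that] distributed_measurable[OF w(2)[OF that]]
    by (intro conjI disjI2 exI[of _ 0] exI[of _ 1]) simp_all
  \<comment> \<open>Together these give \<open>0 \<le> M\<close>, which the monotonicity of the
    product needs below.\<close>
  have E: "0 \<le> E i" "E i \<le> M" if "i \<in> {1..l}" for i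
  proof -
    have "local_extensions H X (\<phi> i) \<noteq> {}"
      using assms(10)[OF that] by (auto simp: lies_locally_in_def local_extensions_def)
    then show "0 \<le> E i" unfolding E_def by (rule cINF_greatest) simp
    show "E i \<le> M" unfolding M_def using that by (intro Max_ge) auto
  qed
  have "\<bar>cov_fun Q (conditioned k x y ft) t t\<bar> \<le> real l * M * \<epsilon>" if t: "t \<in> X" for t
  proof -
    define z where "z = case_option t x"
    define c where "c = case_option 1 (\<lambda>j. - (kernel_vector k t x v* matrix_inv (kernel_matrix k x)) $ j)"
    define b where "b = kernel_vector k t x \<bullet> (matrix_inv (kernel_matrix k x) *v y)"
    define v where "v = (\<Sum>i\<in>UNIV. \<Sum>j\<in>UNIV. c i * c j * k (z i) (z j))"
    \<comment> \<open>After the two sums are swapped, \<open>d i\<close> is the coefficient of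
      \<open>w i\<close> in the conditioned linear model.\<close>
    define d where "d = (\<lambda>i. \<Sum>p\<in>UNIV. c p * \<phi> i (z p))"
    have z: "range z \<subseteq> X" using t assms(12) by (auto simp: z_def image_subset_iff split: option.splits)
    have "cov_fun P (conditioned k x y f) t t
      = (\<Sum>i\<in>UNIV. \<Sum>j\<in>UNIV. c i * c j * covariance P (f (z i)) (f (z j)))"
      unfolding cov_fun_def c_def z_def
      by (rule covariance_affine[OF P.prob_space_axioms finite f]) (rule conditioned_affine)
    then have "cov_fun P (conditioned k x y f) t t = v"
      using assms(5) by (simp add: v_def cov_fun_def)
    then have v: "v \<le> \<epsilon>"
      using assms(14) t by (auto simp: SUP_le_iff)
    have v0: "0 \<le> v" unfolding v_def by (rule kernel_form_nonneg) simp
    have "conditioned k x y ft t \<omega> = b + (\<Sum>i=1..l. d i * w i \<omega>)" if "\<omega> \<in> space Q" for \<omega>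
    proof -
      have "conditioned k x y ft t \<omega> = b + (\<Sum>p\<in>UNIV. c p * ft (z p) \<omega>)"
        unfolding b_def c_def z_def by (rule conditioned_affine)
      also have "(\<Sum>p\<in>UNIV. c p * ft (z p) \<omega>) = (\<Sum>p\<in>UNIV. \<Sum>i=1..l. c p * \<phi> i (z p) * w i \<omega>)"
        using that by (simp add: w(3) sum_distrib_left mult_ac)
      also have "\<dots> = (\<Sum>i=1..l. d i * w i \<omega>)"
        by (subst sum.swap) (simp add: d_def sum_distrib_right)
      finally show ?thesis .
    qed
    \<comment> \<open>The weights now play the role of the Gaussian family; their covariance matrix
      is the identity, so only the diagonal survives.\<close>
    then have "cov_fun Q (conditioned k x y ft) t t
      = (\<Sum>i=1..l. \<Sum>j=1..l. d i * d j * covariance Q (w i) (w j))"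
      unfolding cov_fun_def by (intro covariance_affine Q.prob_space_axioms gw) auto
    also have "\<dots> = (\<Sum>i=1..l. \<Sum>j=1..l. d i * d j * (if i = j then 1 else 0))"
      using Q.covariance_indep_std_normal[OF w(1,2)] by (intro sum.cong refl) auto
    also have "\<dots> = (\<Sum>i=1..l. (d i)\<^sup>2)"
      by (simp add: if_distrib[of "(*) _"] power2_eq_square cong: if_cong)
    finally have cov: "cov_fun Q (conditioned k x y ft) t t = (\<Sum>i=1..l. (d i)\<^sup>2)" .
    have "(d i)\<^sup>2 \<le> M * \<epsilon>" if i: "i \<in> {1..l}" for i
    proof -
      have "(d i)\<^sup>2 \<le> E i * v"
        unfolding d_def E_def v_def using z by (intro square_lincomb_le_INF assms(10)[OF i]) auto
      also have "\<dots> \<le> M * \<epsilon>"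
        using E[OF i] v v0 by (intro mult_mono) auto
      finally show ?thesis .
    qed
    \<comment> \<open>The factor \<open>l\<close> of the constant arises here, from one common bound
      on \<open>l\<close> squares.\<close>
    then have "(\<Sum>i=1..l. (d i)\<^sup>2) \<le> real l * M * \<epsilon>"
      using sum_bounded_above[of "{1..l}" "\<lambda>i. (d i)\<^sup>2" "M * \<epsilon>"] by (simp add: mult.assoc)
    then show ?thesis using cov by (simp add: sum_nonneg)
  qed
  then show ?thesis by (intro SUP_least) (simp add: M_def E_def)
qed

end
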